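(* Let $n\ge 2$, let $P$ be a complex polynomial, and let $Q=\{(z_0,\dots,z_n)\in\mathbb{C}^{n+1} : P(z_0)=\sum_{j=1}^n z_j^2\}$. Let $I\subset\mathbb{R}$ be an interval and let $\gamma: I\to\mathbb{C}$ be a smooth regular curve (i.e. $\dot\gamma\neq 0$ everywhere) such that $P(\gamma(s))\neq 0$ for all $s\in I$, and let $\sqrt{P(\gamma(s))}$ denote a smooth choice of square root along $\gamma$. Then the map $$X: I\times \mathbb{S}^{n-1}\to Q,\qquad X(s,x)=\bigl(\gamma(s),\sqrt{P(\gamma(s))}\,x_1,\dots,\sqrt{P(\gamma(s))}\,x_n\bigr),\qquad x=(x_1,\dots,x_n),$$ is a Lagrangian immersion with respect to (the restriction to $Q$ of) $\omega_0=i\sum_{j=0}^n dz_j\wedge d\bar z_j$; that is, $X$ is an immersion and $X^*\omega_0=0$.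
   Context: $\mathbb{S}^{n-1}$ is the unit sphere of $\mathbb{R}^n$. $\dot\gamma$ is the derivative of $\gamma$ in $s$. At points with $P(z_0)\ne0$, $Q$ is a smooth complex hypersurface of $\mathbb{C}^{n+1}$ of complex dimension $n$, and it carries the Kähler structure induced from $\mathbb{C}^{n+1}$. Replacing the square root by its opposite does not change the image of $X$. *)

theory Defs
  imports "HOL-Analysis.Analysis" "HOL-Computational_Algebra.Polynomial"
begin

(* C^k on an open set U of a finite-dimensional space: all iterated directional
   derivatives up to order k exist and are continuous. *)
primrec Ck_on :: "nat \<Rightarrow> 'a::euclidean_space set \<Rightarrow> ('a \<Rightarrow> 'b::real_normed_vector) \<Rightarrow> bool" where
  "Ck_on 0 U f \<longleftrightarrow> continuous_on U f"
| "Ck_on (Suc k) U f \<longleftrightarrow>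
     (\<forall>x\<in>U. f differentiable (at x)) \<and>
     (\<forall>v. Ck_on k U (\<lambda>x. frechet_derivative f (at x) v))"

(* Smoothness on an arbitrary subset M of a Euclidean space: f is locally the restriction
   of a C^infinity map defined on an open set of the ambient space.  M may thus be an interval
   containing endpoints, an embedded submanifold, or a product of the two. *)
definition smooth_on :: "'a::euclidean_space set \<Rightarrow> ('a \<Rightarrow> 'b::real_normed_vector) \<Rightarrow> bool" where
  "smooth_on M f \<longleftrightarrow>
     (\<forall>p\<in>M. \<exists>U g. open U \<and> p \<in> U \<and> (\<forall>k. Ck_on k U g) \<and> (\<forall>x\<in>M \<inter> U. g x = f x))"

(* Initial velocities of curves in M issuing from p.  The curves are one-sided so that
   boundary points are covered; the real span then gives the full tangent space there. *)
definition tangent_space :: "'a::euclidean_space set \<Rightarrow> 'a \<Rightarrow> 'a set" where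
  "tangent_space M p =
     span {v. \<exists>c e. 0 < e \<and> c 0 = p \<and> c ` {0..e} \<subseteq> M \<and>
                    (c has_vector_derivative v) (at 0 within {0..e})}"

(* A Frechet derivative relative to M is not unique on the ambient space, but by the chain
   rule along curves its values on tangent_space M p are determined by f and M. *)
abbreviation differential_on ::
    "'a::euclidean_space set \<Rightarrow> ('a \<Rightarrow> 'b::real_normed_vector) \<Rightarrow> 'a \<Rightarrow> 'a \<Rightarrow> 'b" where
  "differential_on M f p \<equiv> frechet_derivative f (at p within M)"

definition immersion_on :: "'a::euclidean_space set \<Rightarrow> ('a \<Rightarrow> 'b::real_normed_vector) \<Rightarrow> bool" where
  "immersion_on M f \<longleftrightarrow>
     smooth_on M f \<and> (\<forall>p\<in>M. inj_on (differential_on M f p) (tangent_space M p))"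

definition pullback_form ::
    "'a::euclidean_space set \<Rightarrow> ('a \<Rightarrow> 'b::real_normed_vector) \<Rightarrow> ('b \<Rightarrow> 'b \<Rightarrow> complex)
       \<Rightarrow> 'a \<Rightarrow> 'a \<Rightarrow> 'a \<Rightarrow> complex" where
  "pullback_form M f \<omega> p u v = \<omega> (differential_on M f p u) (differential_on M f p v)"

(* M is mapped into N, and \<omega> is a constant-coefficient 2-form on the ambient space of N.
   The last clause is the half-dimensionality contained in the word Lagrangian (dim is the
   real dimension). *)
definition lagrangian_immersion ::
    "'a::euclidean_space set \<Rightarrow> 'b::euclidean_space set \<Rightarrow> ('b \<Rightarrow> 'b \<Rightarrow> complex)
       \<Rightarrow> ('a \<Rightarrow> 'b) \<Rightarrow> bool" where
  "lagrangian_immersion M N \<omega> f \<longleftrightarrow>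
     f ` M \<subseteq> N \<and>
     immersion_on M f \<and>
     (\<forall>p\<in>M. \<forall>u\<in>tangent_space M p. \<forall>v\<in>tangent_space M p. pullback_form M f \<omega> p u v = 0) \<and>
     (\<forall>p\<in>M. dim (tangent_space N (f p)) = 2 * dim (tangent_space M p))"

definition wedge :: "('a \<Rightarrow> complex) \<Rightarrow> ('a \<Rightarrow> complex) \<Rightarrow> 'a \<Rightarrow> 'a \<Rightarrow> complex" where
  "wedge \<alpha> \<beta> u v = \<alpha> u * \<beta> v - \<alpha> v * \<beta> u"

(* C^(n+1) is modelled as complex \<times> (complex^'n) with n = CARD('n): the first component is z_0,
   the second is (z_1, ..., z_n). *)
definition omega0 :: "complex \<times> (complex^'n) \<Rightarrow> complex \<times> (complex^'n) \<Rightarrow> complex" where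
  "omega0 u v =
     \<i> * (wedge fst (\<lambda>z. cnj (fst z)) u v +
          (\<Sum>j\<in>UNIV. wedge (\<lambda>z. snd z $ j) (\<lambda>z. cnj (snd z $ j)) u v))"

definition quadric :: "complex poly \<Rightarrow> (complex \<times> (complex^'n)) set" where
  "quadric P = {z. poly P (fst z) = (\<Sum>j\<in>UNIV. (snd z $ j)\<^sup>2)}"

end

theory Submission
  imports Defs
begin

text \<open>
  The tangent space of \<open>I \<times> S\<close> at \<open>(s, x)\<close> consists of the pairs \<open>(a, w)\<close> with \<open>w\<close> orthogonal to
  \<open>x\<close> (\<open>tangent_space_interval_sphere\<close>), and on it the differential of \<open>X\<close> is
  \<open>(a, w) \<mapsto> (a \<gamma>', r w + a r' x)\<close>. It is injective because \<open>\<gamma>'\<close> and \<open>r\<close> do not vanish. The form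
  \<open>\<omega>\<^sub>0\<close> is a multiple of the imaginary part of the Hermitian product. The Hermitian product of two
  image vectors is \<open>a b |\<gamma>'|\<^sup>2 + |r|\<^sup>2 (w \<bullet> u) + a b |r'|\<^sup>2\<close>, a real number, since the two mixed terms
  contain the factors \<open>x \<bullet> w = 0\<close> and \<open>x \<bullet> u = 0\<close> (\<open>omega0_cscale_eq_0\<close>). That \<open>X\<close> lands in the
  quadric is the identity \<open>r\<^sup>2 (x \<bullet> x) = r\<^sup>2 = P(\<gamma>)\<close>.

  Half-dimensionality needs the tangent space of the quadric at a point with \<open>P(z\<^sub>0) \<noteq> 0\<close>: it is the
  kernel of a nonzero complex linear functional (\<open>tangent_space_quadric\<close>), hence of real dimension
  \<open>2n\<close>. Instead of the implicit function theorem, the proof writes down a curve with prescribed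
  velocity: move along a straight line in \<open>\<complex>\<^sup>n\<^sup>+\<^sup>1\<close> and rescale the last \<open>n\<close> coordinates by a complex
  square root, so as to return to the quadric.

  Two general facts connect this with the definitions. Derivatives relative to a set are not unique,
  but any two agree on tangent vectors (\<open>derivative_unique_on_tangent_space\<close>), so the formula for the
  differential may be used whichever derivative is chosen. And maps of class \<open>C\<^sup>k\<close> are closed under
  bilinear combinations and under composition with the projection to the first factor, so local
  smooth extensions of \<open>\<gamma>\<close> and \<open>r\<close> give one of \<open>X\<close>.
\<close>

section \<open>Calculus of functions of class C^k\<close>

lemma Ck_on_cong:
  fixes f g :: "'a::euclidean_space \<Rightarrow> 'b::real_normed_vector"
  assumes "open U" "\<forall>x\<in>U. f x = g x" "Ck_on k U f"
  shows "Ck_on k U g"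
  using assms(2,3)
proof (induction k arbitrary: f g)
  case 0
  then show ?case by (auto cong: continuous_on_cong)
next
  case (Suc k)
  have g: "(g has_derivative frechet_derivative f (at x)) (at x)" if "x \<in> U" for x
  proof (rule has_derivative_transform_within_open[OF _ \<open>open U\<close> that])
    show "(f has_derivative frechet_derivative f (at x)) (at x)"
      using Suc.prems that by (auto simp: frechet_derivative_works)
  qed (use Suc.prems in auto)
  then have eq: "\<forall>x\<in>U. frechet_derivative f (at x) v = frechet_derivative g (at x) v" for v
    by (metis frechet_derivative_at)
  have "Ck_on k U (\<lambda>x. frechet_derivative g (at x) v)" for v
    by (rule Suc.IH[OF eq]) (use Suc.prems in auto)
  then show ?case using g by (auto simp: differentiable_def)
qed

text \<open>Computing with a known derivative \<open>f'\<close> avoids the choice operator behind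
  \<^const>\<open>frechet_derivative\<close>, which is only meaningful at points of \<open>U\<close>; openness of \<open>U\<close> makes the
  values elsewhere irrelevant.\<close>

lemma Ck_on_SucI:
  assumes "open U" "\<And>x. x \<in> U \<Longrightarrow> (f has_derivative f' x) (at x)"
    and "\<And>v. Ck_on k U (\<lambda>x. f' x v)"
  shows "Ck_on (Suc k) U f"
proof -
  have "\<forall>x\<in>U. f' x v = frechet_derivative f (at x) v" for v
    using assms(2) frechet_derivative_at by metis
  from Ck_on_cong[OF assms(1) this assms(3)] show ?thesis
    using assms(2) by (auto simp: differentiable_def)
qed

lemma Ck_on_SucD:
  assumes "Ck_on (Suc k) U f" "x \<in> U"
  shows "(f has_derivative frechet_derivative f (at x)) (at x)"
  using assms by (auto simp: frechet_derivative_works)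

lemma Ck_on_antimono_order:
  assumes "Ck_on (Suc k) U f"
  shows "Ck_on k U f"
  using assms
proof (induction k arbitrary: f)
  case 0
  then show ?case
    using differentiable_imp_continuous_within
    by (auto intro!: continuous_at_imp_continuous_on)
next
  case (Suc k)
  then show ?case by (metis Ck_on.simps(2))
qed

lemma Ck_on_subset:
  assumes "Ck_on k U f" "V \<subseteq> U"
  shows "Ck_on k V f"
  using assms(1)
proof (induction k arbitrary: f)
  case 0
  then show ?case using assms(2) by (auto intro: continuous_on_subset)
next
  case (Suc k)
  then show ?case using assms(2) by auto
qed

lemma Ck_on_const: "open U \<Longrightarrow> Ck_on k U (\<lambda>x. c)"
proof (induction k arbitrary: c)
  case (Suc k)
  then show ?case by (intro Ck_on_SucI[where f' = "\<lambda>x v. 0"]) auto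
qed simp

lemma Ck_on_bounded_linear:
  assumes "open U" "bounded_linear L"
  shows "Ck_on k U L"
proof (cases k)
  case 0
  then show ?thesis
    using bounded_linear.continuous_on[OF assms(2) continuous_on_id] by simp
next
  case (Suc m)
  then show ?thesis
    using Ck_on_SucI[OF assms(1) bounded_linear_imp_has_derivative[OF assms(2)]
        Ck_on_const[OF assms(1)]] by blast
qed

lemma Ck_on_add:
  assumes "open U" "Ck_on k U f" "Ck_on k U g"
  shows "Ck_on k U (\<lambda>x. f x + g x)"
  using assms(2,3)
proof (induction k arbitrary: f g)
  case 0
  then show ?case by (auto intro: continuous_intros)
next
  case (Suc k)
  show ?case
    by (rule Ck_on_SucI[OF assms(1) has_derivative_add[OF Ck_on_SucD[OF Suc.prems(1)]
        Ck_on_SucD[OF Suc.prems(2)]]], assumption, assumption) (use Suc in auto)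
qed

text \<open>Leibniz rule: the derivative is again a sum of bilinear expressions in functions that are one
  order less smooth. The undifferentiated factors enter it too, which is why lowering the order of
  differentiability is needed.\<close>

lemma Ck_on_bilinear:
  assumes "bounded_bilinear B" "open U" "Ck_on k U f" "Ck_on k U g"
  shows "Ck_on k U (\<lambda>x. B (f x) (g x))"
  using assms(3,4)
proof (induction k arbitrary: f g)
  case 0
  then show ?case by (auto intro: bounded_bilinear.continuous_on[OF assms(1)])
next
  case (Suc k)
  have low: "Ck_on k U f" "Ck_on k U g"
    using Suc.prems by (auto intro: Ck_on_antimono_order simp del: Ck_on.simps)
  show ?case
  proof (rule Ck_on_SucI[OF assms(2) bounded_bilinear.FDERIV[OF assms(1) Ck_on_SucD[OF Suc.prems(1)]
        Ck_on_SucD[OF Suc.prems(2)]]], assumption, assumption)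
    fix v
    show "Ck_on k U (\<lambda>x. B (f x) (frechet_derivative g (at x) v) +
            B (frechet_derivative f (at x) v) (g x))"
      by (intro Ck_on_add[OF assms(2)] Suc.IH low) (use Suc.prems in auto)
  qed
qed

lemma Ck_on_bounded_linear_compose:
  assumes "bounded_linear L" "open U" "Ck_on k U f"
  shows "Ck_on k U (\<lambda>x. L (f x))"
  using assms(3)
proof (induction k arbitrary: f)
  case 0
  then show ?case by (auto intro: bounded_linear.continuous_on[OF assms(1)])
next
  case (Suc k)
  show ?case
    by (rule Ck_on_SucI[OF assms(2) bounded_linear.has_derivative[OF assms(1)
        Ck_on_SucD[OF Suc.prems]]], assumption) (use Suc in auto)
qed

lemma Ck_on_compose_fst:
  fixes g :: "'a::euclidean_space \<Rightarrow> 'c::real_normed_vector"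
  assumes "open U" "Ck_on k U g"
  shows "Ck_on k (U \<times> (UNIV :: 'b::euclidean_space set)) (\<lambda>p. g (fst p))"
  using assms(2)
proof (induction k arbitrary: g)
  case 0
  then have "continuous_on U g" by simp
  then show ?case
    using continuous_on_compose2[OF _ continuous_on_fst[OF continuous_on_id], of U g "U \<times> UNIV"] by auto
next
  case (Suc k)
  show ?case
  proof (rule Ck_on_SucI)
    fix p :: "'a \<times> 'b" assume p: "p \<in> U \<times> UNIV"
    show "((\<lambda>p. g (fst p)) has_derivative (\<lambda>v. frechet_derivative g (at (fst p)) (fst v))) (at p)"
      by (rule has_derivative_compose[OF has_derivative_fst[OF has_derivative_ident]])
        (use p in \<open>auto intro!: Ck_on_SucD[OF Suc.prems]\<close>)
  next
    show "open (U \<times> (UNIV :: 'b set))" using assms(1) by (simp add: open_Times)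
    show "Ck_on k (U \<times> (UNIV :: 'b set)) (\<lambda>p. frechet_derivative g (at (fst p)) (fst v))" for v :: "'a \<times> 'b"
      using Suc.IH[of "\<lambda>y. frechet_derivative g (at y) (fst v)"] Suc.prems by simp
  qed
qed

section \<open>Tangent spaces\<close>

lemma subspace_tangent_space: "subspace (tangent_space M p)"
  by (simp add: tangent_space_def)

lemma tangent_spaceI:
  assumes "0 < e" "c 0 = p" "\<And>t. 0 \<le> t \<Longrightarrow> t \<le> e \<Longrightarrow> c t \<in> M"
    "(c has_vector_derivative v) (at 0)"
  shows "v \<in> tangent_space M p"
  unfolding tangent_space_def
  by (rule span_base)
    (use assms in \<open>auto intro!: exI[of _ c] exI[of _ e] has_vector_derivative_at_within\<close>)

text \<open>By the chain rule along a curve with velocity \<open>v\<close>, both \<open>D v\<close> and \<open>D' v\<close> are the one-sided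
  derivative of \<open>f \<circ> c\<close> at \<open>0\<close>, which is unique; linearity extends this to the span of velocities.\<close>

lemma derivative_unique_on_tangent_space:
  assumes "(f has_derivative D) (at p within M)" "(f has_derivative D') (at p within M)"
    and "v \<in> tangent_space M p"
  shows "D v = D' v"
proof -
  have *: "D v = D' v" if "0 < e" "c 0 = p" "c ` {0..e} \<subseteq> M"
    "(c has_vector_derivative v) (at 0 within {0..e})" for c e v
  proof -
    have "((f \<circ> c) has_vector_derivative E v) (at 0 within {0..e})"
      if E: "(f has_derivative E) (at p within M)" for E
      using that \<open>c 0 = p\<close> \<open>c ` {0..e} \<subseteq> M\<close> \<open>(c has_vector_derivative v) (at 0 within {0..e})\<close>
      by (intro vector_derivative_diff_chain_within) (auto intro: has_derivative_subset)
    from this[OF assms(1)] this[OF assms(2)] show ?thesis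
      using \<open>0 < e\<close> by (intro vector_derivative_unique_within[of 0 "{0..e}"])
        (auto simp: trivial_limit_within islimpt_Icc)
  qed
  interpret D: linear D using assms(1) by (rule has_derivative_linear)
  interpret D': linear D' using assms(2) by (rule has_derivative_linear)
  show ?thesis
    using assms(3) unfolding tangent_space_def
    by (rule linear_eq_on_span[OF D.linear_axioms D'.linear_axioms, rotated])
      (use * in auto)
qed

text \<open>This yields the upper bounds for tangent spaces of level sets: relative to \<open>M\<close>, the constant
  function \<open>G\<close> also has derivative \<open>0\<close>, so the previous uniqueness applies.\<close>

lemma derivative_vanishes_on_tangent_space:
  assumes "(G has_derivative D) (at p)" "\<And>y. y \<in> M \<Longrightarrow> G y = k" "p \<in> M"
    and "v \<in> tangent_space M p"
  shows "D v = 0"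
proof -
  have "(G has_derivative (\<lambda>_. 0)) (at p within M)"
    by (rule has_derivative_transform[OF \<open>p \<in> M\<close>, of _ "\<lambda>_. k"]) (use assms(2) in auto)
  from derivative_unique_on_tangent_space[OF has_derivative_at_withinI[OF assms(1)] this assms(4)]
  show ?thesis .
qed

text \<open>Rank-nullity, from the splitting of the domain into the kernel and the range of a linear
  right inverse.\<close>

lemma dim_kernel_surj:
  fixes f :: "'a::euclidean_space \<Rightarrow> 'b::euclidean_space"
  assumes "linear f" "surj f"
  shows "dim {v. f v = 0} + DIM('b) = DIM('a)"
proof -
  interpret f: linear f by fact
  obtain g where g: "linear g" "f \<circ> g = id"
    using linear_surjective_right_inverse[OF assms] by blast
  interpret g: linear g by fact
  have fg: "f (g y) = y" for y using g(2) by (metis comp_apply id_apply)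
  have sub: "subspace {v. f v = 0}" "subspace (range g)"
    by (rule linear_subspace_kernel[OF assms(1)], rule linear_subspace_image[OF g(1) subspace_UNIV])
  have "dim (range g) = DIM('b)"
    using dim_image_eq[OF g(1), of UNIV] fg by (metis dim_UNIV inj_on_def)
  moreover have "{x + y |x y. x \<in> {v. f v = 0} \<and> y \<in> range g} = UNIV"
  proof -
    have "v = (v - g (f v)) + g (f v)" "f (v - g (f v)) = 0" for v
      by (auto simp: f.diff fg)
    then show ?thesis by blast
  qed
  moreover have "{v. f v = 0} \<inter> range g = {0}"
    using fg f.zero g.zero by (auto intro: range_eqI[of _ _ 0])
  ultimately show ?thesis
    using dim_sums_Int[OF sub] by simp
qed

text \<open>The interval direction comes from a segment towards any other point \<open>t\<close> of \<open>I\<close>, which stays in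
  \<open>I\<close> even if \<open>s\<close> is an endpoint; its velocity may point either way, so only the span contains
  both directions. The sphere directions come from great circles.\<close>

lemma tangent_space_interval_sphere:
  fixes I :: "real set" and x :: "'a::euclidean_space"
  assumes "is_interval I" "interior I \<noteq> {}" "s \<in> I" "norm x = 1"
  shows "tangent_space (I \<times> sphere 0 1) (s, x) = {(a, w). x \<bullet> w = 0}" (is "?T = _")
proof (intro subset_antisym subsetI)
  fix v :: "real \<times> 'a" assume v: "v \<in> ?T"
  have "((\<lambda>p. snd p \<bullet> snd p) has_derivative (\<lambda>v. x \<bullet> snd v + snd v \<bullet> x)) (at (s, x))"
    by (auto intro!: derivative_eq_intros)
  from derivative_vanishes_on_tangent_space[OF this _ _ v, of 1]
  show "v \<in> {(a, w). x \<bullet> w = 0}"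
    using assms by (auto simp: inner_commute dot_square_norm)
next
  fix v :: "real \<times> 'a" assume "v \<in> {(a, w). x \<bullet> w = 0}"
  then obtain a w where v: "v = (a, w)" "x \<bullet> w = 0" by auto
  obtain t where t: "t \<in> I" "t \<noteq> s"
  proof -
    have "\<not> I \<subseteq> {s}"
      using assms(2) interior_mono[of I "{s}"] by auto
    then show ?thesis using that by blast
  qed
  have "(t - s, 0) \<in> ?T"
  proof (rule tangent_spaceI[of 1 "\<lambda>\<tau>. (s + \<tau> * (t - s), x)"])
    fix \<tau> :: real assume "0 \<le> \<tau>" "\<tau> \<le> 1"
    then have "(1 - \<tau>) *\<^sub>R s + \<tau> *\<^sub>R t \<in> I"
      using convexD[OF is_interval_convex[OF assms(1)] assms(3) t(1), of "1 - \<tau>" \<tau>] by simp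
    then show "(s + \<tau> * (t - s), x) \<in> I \<times> sphere 0 1"
      using assms(4) by (simp add: algebra_simps)
  qed (auto intro!: derivative_eq_intros has_vector_derivative_Pair simp flip: has_real_derivative_iff_has_vector_derivative)
  from subspace_scale[OF subspace_tangent_space this, of "a / (t - s)"]
  have 1: "(a, 0) \<in> ?T" using t(2) by simp
  have 2: "(0, w) \<in> ?T"
  proof (cases "w = 0")
    case True
    then show ?thesis
      using subspace_0[OF subspace_tangent_space] by (metis zero_prod_def)
  next
    case False
    have xx: "x \<bullet> x = 1" using assms(4) by (simp add: dot_square_norm)
    define u where "u = w /\<^sub>R norm w"
    have u: "u \<bullet> u = 1" "x \<bullet> u = 0"
      using False v(2) by (auto simp: u_def dot_square_norm power2_eq_square field_simps)
    have "(0, u) \<in> ?T"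
    proof (rule tangent_spaceI[of 1 "\<lambda>\<tau>. (s, cos \<tau> *\<^sub>R x + sin \<tau> *\<^sub>R u)"])
      fix \<tau> :: real
      have "(cos \<tau> *\<^sub>R x + sin \<tau> *\<^sub>R u) \<bullet> (cos \<tau> *\<^sub>R x + sin \<tau> *\<^sub>R u) = (cos \<tau>)\<^sup>2 + (sin \<tau>)\<^sup>2"
        using u xx by (simp add: inner_add inner_commute[of u x] power2_eq_square)
      then show "(s, cos \<tau> *\<^sub>R x + sin \<tau> *\<^sub>R u) \<in> I \<times> sphere 0 1"
        using assms(3) by (simp add: norm_eq_1)
    next
      have "((\<lambda>\<tau>. cos \<tau> *\<^sub>R x + sin \<tau> *\<^sub>R u) has_vector_derivative u) (at 0)"
        by (auto intro!: derivative_eq_intros)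
      then show "((\<lambda>\<tau>. (s, cos \<tau> *\<^sub>R x + sin \<tau> *\<^sub>R u)) has_vector_derivative (0, u)) (at 0)"
        by (intro has_vector_derivative_Pair) auto
    qed auto
    from subspace_scale[OF subspace_tangent_space this, of "norm w"]
    show ?thesis using False by (simp add: u_def)
  qed
  show "v \<in> ?T"
    using subspace_add[OF subspace_tangent_space 1 2] v by simp
qed

lemma dim_tangent_space_interval_sphere:
  fixes I :: "real set" and x :: "'a::euclidean_space"
  assumes "is_interval I" "interior I \<noteq> {}" "s \<in> I" "norm x = 1"
  shows "dim (tangent_space (I \<times> sphere 0 1) (s, x)) = DIM('a)"
proof -
  have "tangent_space (I \<times> sphere 0 1) (s, x) = {v. (0::real, x) \<bullet> v = 0}"
    unfolding tangent_space_interval_sphere[OF assms] by (auto simp: inner_Pair)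
  moreover have "(0::real, x) \<noteq> 0"
    using assms(4) by (auto simp: zero_prod_def)
  ultimately show ?thesis
    using dim_hyperplane[of "(0::real, x)"] by (simp add: DIM_prod)
qed

section \<open>The quadric\<close>

text \<open>The differential at \<open>z\<close> of the defining function of the quadric.\<close>

definition dquadric :: "complex poly \<Rightarrow> complex \<times> (complex^'n) \<Rightarrow> complex \<times> (complex^'n) \<Rightarrow> complex" where
  "dquadric P z v = poly (pderiv P) (fst z) * fst v - (\<Sum>j\<in>UNIV. 2 * (snd z $ j) * (snd v $ j))"

lemma linear_dquadric: "linear (dquadric P z)"
  by (rule linearI) (auto simp: dquadric_def algebra_simps sum.distrib scaleR_sum_right)

text \<open>Write \<open>q(z) = \<Sum>\<^sub>j z\<^sub>j\<^sup>2\<close>. Given \<open>v\<close> in the kernel, take the straight line \<open>z + t v\<close> and multiply its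
  last \<open>n\<close> coordinates by \<open>l(t)\<close> with \<open>l\<^sup>2 = P / q\<close>; the result lies in the quadric because \<open>q\<close> is
  homogeneous of degree two. At \<open>t = 0\<close> the quotient is \<open>1\<close>, away from the branch cut of the square
  root. The kernel condition says precisely that \<open>P\<close> and \<open>q\<close> have the same derivative along the line
  at \<open>t = 0\<close>, so \<open>l' = 0\<close> there and the rescaling does not alter the velocity \<open>v\<close>.\<close>

lemma tangent_space_quadric:
  fixes z :: "complex \<times> (complex^'n)"
  assumes z: "z \<in> quadric P" and nz: "poly P (fst z) \<noteq> 0"
  shows "tangent_space (quadric P) z = {v. dquadric P z v = 0}"
proof (intro subset_antisym subsetI)
  fix v assume v: "v \<in> tangent_space (quadric P) z"
  have P: "((\<lambda>y. poly P (fst y)) has_derivative (\<lambda>v. poly (pderiv P) (fst z) * fst v)) (at z)"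
    by (rule has_derivative_compose[of fst fst z UNIV "poly P"])
      (auto intro!: derivative_eq_intros poly_DERIV[THEN has_field_derivative_imp_has_derivative])
  have c: "((\<lambda>y. snd y $ j) has_derivative (\<lambda>v. snd v $ j)) (at z)" for j :: 'n
    by (auto intro!: bounded_linear_imp_has_derivative bounded_linear_compose[OF bounded_linear_vec_nth bounded_linear_snd])
  have "((\<lambda>y. poly P (fst y) - (\<Sum>j\<in>UNIV. (snd y $ j)\<^sup>2)) has_derivative dquadric P z) (at z)"
    by (rule derivative_eq_intros P c refl)+ (auto simp: dquadric_def fun_eq_iff algebra_simps)
  from derivative_vanishes_on_tangent_space[OF this _ z v, of 0]
  show "v \<in> {v. dquadric P z v = 0}" by (auto simp: quadric_def)
next
  fix v assume "v \<in> {v. dquadric P z v = 0}"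
  then have ker: "poly (pderiv P) (fst z) * fst v = 2 * (\<Sum>j\<in>UNIV. snd z $ j * snd v $ j)"
    by (simp add: dquadric_def sum_distrib_left algebra_simps)
  define p where "p t = poly P (fst z + of_real t * fst v)" for t :: real
  define q where "q t = (\<Sum>j\<in>UNIV. (snd z $ j + of_real t * snd v $ j)\<^sup>2)" for t :: real
  define l where "l t = csqrt (p t / q t)" for t
  define c where "c t = (fst z + of_real t * fst v, \<chi> j. l t * (snd z $ j + of_real t * snd v $ j))" for t
  have q0: "q 0 = poly P (fst z)" and p0: "p 0 = poly P (fst z)"
    using z by (auto simp: q_def p_def quadric_def)
  have lin: "((\<lambda>t. a + of_real t * b) has_vector_derivative b) (at 0)" for a b :: complex
    by (auto intro!: derivative_eq_intros)
  have dp: "(p has_vector_derivative fst v * poly (pderiv P) (fst z)) (at 0)"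
    using field_vector_diff_chain_at[OF lin[of "fst z" "fst v"], of "poly P"]
    unfolding p_def comp_def by (auto intro: poly_DERIV)
  have dq: "(q has_vector_derivative fst v * poly (pderiv P) (fst z)) (at 0)"
  proof -
    have sq: "((\<lambda>x. x\<^sup>2) has_field_derivative 2 * a) (at a)" for a :: complex
      by (auto intro!: derivative_eq_intros)
    have "((\<lambda>t. (snd z $ j + of_real t * snd v $ j)\<^sup>2) has_vector_derivative snd v $ j * (2 * snd z $ j)) (at 0)" for j
      using field_vector_diff_chain_at[OF lin[of "snd z $ j" "snd v $ j"], of "\<lambda>x. x\<^sup>2" "2 * snd z $ j"]
        sq[of "snd z $ j"] by (simp add: comp_def)
    then have "(q has_vector_derivative (\<Sum>j\<in>UNIV. snd v $ j * (2 * snd z $ j))) (at 0)"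
      unfolding q_def by (intro has_vector_derivative_sum) auto
    then show ?thesis using ker by (simp add: sum_distrib_left algebra_simps)
  qed
  have dl: "(l has_vector_derivative 0) (at 0)"
  proof -
    have inv: "(inverse has_field_derivative - (inverse y * inverse y)) (at y)" if "y \<noteq> 0" for y :: complex
      using DERIV_inverse[OF that, of UNIV] by (simp add: power2_eq_square)
    have iq: "((\<lambda>t. inverse (q t)) has_vector_derivative
        (fst v * poly (pderiv P) (fst z)) * - (inverse (q 0) * inverse (q 0))) (at 0)"
      using field_vector_diff_chain_at[OF dq inv] nz q0 by (simp add: comp_def)
    have "((\<lambda>t. p t * inverse (q t)) has_vector_derivative 0) (at 0)"
      by (rule has_vector_derivative_eq_rhs[OF has_vector_derivative_mult[OF dp iq]])
        (simp add: p0 q0 nz field_simps)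
    moreover have "(csqrt has_field_derivative inverse (2 * csqrt 1)) (at (p 0 * inverse (q 0)))"
      using nz p0 q0 has_field_derivative_csqrt[of 1] by simp
    ultimately show ?thesis
      using field_vector_diff_chain_at[of "\<lambda>t. p t * inverse (q t)" 0 0 csqrt "inverse (2 * csqrt 1)"]
      unfolding l_def comp_def divide_inverse by simp
  qed
  have l0: "l 0 = 1" using nz by (simp add: l_def p0 q0)
  have "isCont q 0" using dq by (rule has_vector_derivative_continuous)
  then obtain d where d: "d > 0" "\<And>t. dist 0 t < d \<Longrightarrow> q t \<noteq> 0"
    using continuous_at_avoid[of 0 q 0] nz q0 by auto
  show "v \<in> tangent_space (quadric P) z"
  proof (rule tangent_spaceI[of "d / 2" c])
    show "c 0 = z" by (auto simp: c_def l0 prod_eq_iff vec_eq_iff)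
    show "c t \<in> quadric P" if "0 \<le> t" "t \<le> d / 2" for t
    proof -
      have "q t \<noteq> 0" using d that by (auto simp: dist_real_def)
      then have "(l t)\<^sup>2 * q t = p t" by (simp add: l_def)
      then show ?thesis
        by (simp add: quadric_def c_def p_def q_def power_mult_distrib sum_distrib_left)
    qed
    have "((\<lambda>t. l t * (snd z $ j + of_real t * snd v $ j)) has_vector_derivative snd v $ j) (at 0)" for j
      using has_vector_derivative_mult[OF dl lin[of "snd z $ j" "snd v $ j"]] by (simp add: l0)
    note comp = has_derivative_inner_left[OF this[unfolded has_vector_derivative_def]]
    have "((\<lambda>t. \<chi> j. l t * (snd z $ j + of_real t * snd v $ j)) has_vector_derivative snd v) (at 0)"
      unfolding has_vector_derivative_def
      by (subst has_derivative_componentwise_within) (use comp in \<open>auto simp: Basis_vec_def inner_axis\<close>)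
    from has_vector_derivative_Pair[OF lin[of "fst z" "fst v"] this]
    show "(c has_vector_derivative v) (at 0)" unfolding c_def by simp
  qed (use d in auto)
qed

text \<open>Since \<open>q(z) = P(z\<^sub>0) \<noteq> 0\<close>, some coordinate \<open>z\<^sub>j\<close> is nonzero, and varying it alone already makes
  the functional surjective onto \<open>\<complex>\<close>.\<close>

lemma dim_tangent_space_quadric:
  fixes z :: "complex \<times> (complex^'n)"
  assumes z: "z \<in> quadric P" and nz: "poly P (fst z) \<noteq> 0"
  shows "dim (tangent_space (quadric P) z) = 2 * CARD('n)"
proof -
  obtain j where j: "snd z $ j \<noteq> 0"
    using z nz by (fastforce simp: quadric_def intro: sum.neutral)
  have "surj (dquadric P z)"
  proof (rule surjI)
    fix y
    have "(\<Sum>i\<in>UNIV. 2 * snd z $ i * (if i = j then - y / (2 * snd z $ j) else 0)) = - y"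
      using j by (simp add: if_distrib cong: if_cong)
    then show "dquadric P z (0, \<chi> i. if i = j then - y / (2 * snd z $ j) else 0) = y"
      by (simp add: dquadric_def)
  qed
  from dim_kernel_surj[OF linear_dquadric this] show ?thesis
    unfolding tangent_space_quadric[OF assms] by simp
qed

section \<open>The immersion\<close>

definition cscale :: "complex \<Rightarrow> real^'n \<Rightarrow> complex^'n" where
  "cscale c x = (\<chi> j. c * complex_of_real (x $ j))"

lemma bounded_bilinear_cscale: "bounded_bilinear (cscale :: complex \<Rightarrow> real^'n \<Rightarrow> complex^'n)"
  unfolding bilinear_conv_bounded_bilinear[symmetric] bilinear_def cscale_def
  by (auto intro!: linearI simp: vec_eq_iff complex_eq_iff algebra_simps)

text \<open>Local smooth extensions \<open>g\<close> and \<open>h\<close> of \<open>\<gamma>\<close> and \<open>r\<close> combine to the extension \<open>F\<close>. Splitting \<open>F\<close> as a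
  sum makes each summand a linear map applied to a function built from the calculus above.\<close>

lemma smooth_on_pair_cscale:
  fixes I :: "real set" and M :: "(real^'n) set"
  assumes "smooth_on I \<gamma>" "smooth_on I r"
  shows "smooth_on (I \<times> M) (\<lambda>(s, x::real^'n). (\<gamma> s, cscale (r s) x))"
  unfolding smooth_on_def
proof clarify
  fix s and x :: "real^'n" assume "s \<in> I" "x \<in> M"
  obtain U g where U: "open U" "s \<in> U" "\<And>k. Ck_on k U g" "\<forall>x\<in>I \<inter> U. g x = \<gamma> x"
    using assms(1) \<open>s \<in> I\<close> unfolding smooth_on_def by blast
  obtain V h where V: "open V" "s \<in> V" "\<And>k. Ck_on k V h" "\<forall>x\<in>I \<inter> V. h x = r x"
    using assms(2) \<open>s \<in> I\<close> unfolding smooth_on_def by blast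
  define W where "W = (U \<inter> V) \<times> (UNIV :: (real^'n) set)"
  define F where "F p = (g (fst p), 0) + (0, cscale (h (fst p)) (snd p))" for p :: "real \<times> (real^'n)"
  have W: "open W" using U V by (auto simp: W_def intro: open_Times)
  have "Ck_on k W F" for k
    unfolding F_def
  proof (intro Ck_on_add[OF W] Ck_on_bounded_linear_compose[of "\<lambda>y. (y, 0)"]
      Ck_on_bounded_linear_compose[of "\<lambda>y. (0, y)"] Ck_on_bilinear[OF bounded_bilinear_cscale] W)
    have UV: "open (U \<inter> V)" using U V by auto
    show "Ck_on k W (\<lambda>p. g (fst p))" "Ck_on k W (\<lambda>p. h (fst p))"
      unfolding W_def using Ck_on_subset[OF U(3)] Ck_on_subset[OF V(3)]
      by (auto intro!: Ck_on_compose_fst UV)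
    show "Ck_on k W snd" by (intro Ck_on_bounded_linear W bounded_linear_snd)
  qed (auto intro!: bounded_linear_Pair bounded_linear_zero bounded_linear_ident)
  moreover have "\<forall>p\<in>I \<times> M \<inter> W. F p = (case p of (s, x) \<Rightarrow> (\<gamma> s, cscale (r s) x))"
    using U V by (auto simp: W_def F_def)
  ultimately show "\<exists>U g. open U \<and> (s, x) \<in> U \<and> (\<forall>k. Ck_on k U g) \<and>
      (\<forall>p\<in>I \<times> M \<inter> U. g p = (case p of (s, x) \<Rightarrow> (\<gamma> s, cscale (r s) x)))"
    using W U V by (intro exI[of _ W] exI[of _ F]) (auto simp: W_def)
qed

lemma smooth_on_has_vector_derivative:
  fixes f :: "real \<Rightarrow> 'a::real_normed_vector"
  assumes "smooth_on I f" "s \<in> I"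
  shows "(f has_vector_derivative vector_derivative f (at s within I)) (at s within I)"
proof -
  obtain U g where U: "open U" "s \<in> U" "\<And>k. Ck_on k U g" "\<forall>x\<in>I \<inter> U. g x = f x"
    using assms unfolding smooth_on_def by blast
  have "g differentiable (at s within I)"
    using U(3)[of 1] \<open>s \<in> U\<close> by (auto intro: differentiable_at_withinI)
  then obtain D where "(g has_derivative D) (at s within I)" by (auto simp: differentiable_def)
  \<comment> \<open>\<open>f\<close> and \<open>g\<close> agree only on \<open>I \<inter> U\<close>, which suffices for a derivative relative to \<open>I\<close>.\<close>
  obtain e where e: "e > 0" "ball s e \<subseteq> U" using U openE by blast
  have "(f has_derivative D) (at s within I)"
    by (rule has_derivative_transform_within[OF \<open>(g has_derivative D) _\<close> e(1) assms(2)])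
      (use U(4) e(2) in \<open>auto simp: dist_commute subset_iff\<close>)
  then show ?thesis
    using vector_derivative_works differentiable_def by blast
qed

lemma has_derivative_pair_cscale:
  fixes \<gamma> r :: "real \<Rightarrow> complex"
  assumes "(\<gamma> has_vector_derivative \<gamma>') (at s within I)" "(r has_vector_derivative r') (at s within I)"
  shows "((\<lambda>(s, x::real^'n). (\<gamma> s, cscale (r s) x)) has_derivative
           (\<lambda>(a, w). (a *\<^sub>R \<gamma>', cscale (r s) w + a *\<^sub>R cscale r' x))) (at (s, x) within I \<times> M)"
proof -
  have fst: "(fst has_derivative fst) (at (s, x) within I \<times> M)"
    by (auto intro!: derivative_eq_intros)
  have *: "((\<lambda>p. f (fst p)) has_derivative (\<lambda>v. fst v *\<^sub>R f')) (at (s, x) within I \<times> M)"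
    if "(f has_vector_derivative f') (at s within I)" for f :: "real \<Rightarrow> complex" and f'
    by (rule has_derivative_in_compose[OF fst])
      (use that in \<open>auto simp: has_vector_derivative_def intro: has_derivative_subset\<close>)
  have "((\<lambda>p. (\<gamma> (fst p), cscale (r (fst p)) (snd p))) has_derivative
      (\<lambda>v. (fst v *\<^sub>R \<gamma>', cscale (r s) (snd v) + cscale (fst v *\<^sub>R r') x))) (at (s, x) within I \<times> M)"
    using has_derivative_Pair[OF *[OF assms(1)] bounded_bilinear.FDERIV[OF bounded_bilinear_cscale *[OF assms(2)]
          has_derivative_snd[OF has_derivative_ident]]] by simp
  then show ?thesis
    by (simp add: case_prod_unfold bounded_bilinear.scaleR_left[OF bounded_bilinear_cscale])
qed

text \<open>In coordinate \<open>j\<close>, the terms \<open>|c|\<^sup>2 w\<^sub>j u\<^sub>j\<close> and \<open>a b |d|\<^sup>2 x\<^sub>j\<^sup>2\<close> of the Hermitian product are real and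
  cancel in the antisymmetrisation. What remains is linear in \<open>x\<^sub>j w\<^sub>j\<close> and \<open>x\<^sub>j u\<^sub>j\<close>, so it disappears
  only after summation over \<open>j\<close>, by orthogonality.\<close>

lemma omega0_cscale_eq_0:
  fixes x w u :: "real^'n"
  assumes "x \<bullet> w = 0" "x \<bullet> u = 0"
  shows "omega0 (a *\<^sub>R g, cscale c w + a *\<^sub>R cscale d x) (b *\<^sub>R g, cscale c u + b *\<^sub>R cscale d x) = 0"
proof -
  have orth: "(\<Sum>j\<in>UNIV. complex_of_real (x $ j) * complex_of_real (w $ j)) = 0"
    "(\<Sum>j\<in>UNIV. complex_of_real (x $ j) * complex_of_real (u $ j)) = 0"
    using assms by (auto simp: inner_vec_def simp flip: of_real_mult of_real_sum)
  have "wedge (\<lambda>z. snd z $ j) (\<lambda>z. cnj (snd z $ j))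
      (a *\<^sub>R g, cscale c w + a *\<^sub>R cscale d x) (b *\<^sub>R g, cscale c u + b *\<^sub>R cscale d x)
    = (c * cnj d - cnj c * d) * of_real b * (complex_of_real (x $ j) * complex_of_real (w $ j))
    - (c * cnj d - cnj c * d) * of_real a * (complex_of_real (x $ j) * complex_of_real (u $ j))" for j
    by (simp add: wedge_def cscale_def) (simp add: scaleR_conv_of_real algebra_simps)
  then show ?thesis
    by (simp add: omega0_def sum_subtractf orth flip: sum_distrib_left)
      (simp add: wedge_def scaleR_conv_of_real)
qed

theorem mainTheorem1:
  fixes P :: "complex poly"
    and I :: "real set"
    and \<gamma> r :: "real \<Rightarrow> complex"
  assumes "CARD('n::finite) \<ge> 2"
    and "is_interval I" and "interior I \<noteq> {}"
    and "smooth_on I \<gamma>"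
    and "\<forall>s\<in>I. vector_derivative \<gamma> (at s within I) \<noteq> 0"
    and "\<forall>s\<in>I. poly P (\<gamma> s) \<noteq> 0"
    and "smooth_on I r"
    and "\<forall>s\<in>I. (r s)\<^sup>2 = poly P (\<gamma> s)"
  shows "lagrangian_immersion (I \<times> sphere (0::real^'n) 1)
           (quadric P :: (complex \<times> (complex^'n)) set) omega0
           (\<lambda>(s, x). (\<gamma> s, \<chi> j. r s * complex_of_real (x $ j)))"
proof -
  let ?M = "I \<times> sphere (0::real^'n) 1"
  let ?X = "\<lambda>(s, x::real^'n). (\<gamma> s, cscale (r s) x)"
  define \<gamma>' where "\<gamma>' s = vector_derivative \<gamma> (at s within I)" for s
  define r' where "r' s = vector_derivative r (at s within I)" for s
  have inQ: "(\<gamma> s, cscale (r s) x) \<in> quadric P" if "s \<in> I" "norm x = 1" for s and x :: "real^'n"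
  proof -
    have "(\<Sum>j\<in>UNIV. complex_of_real (x $ j) ^ 2) = of_real (x \<bullet> x)"
      by (simp add: inner_vec_def power2_eq_square)
    also have "\<dots> = 1" using that by (simp add: dot_square_norm)
    finally show ?thesis
      using that assms(8) by (simp add: quadric_def cscale_def power_mult_distrib flip: sum_distrib_left)
  qed
  have D: "differential_on ?M ?X (s, x) (a, w) = (a *\<^sub>R \<gamma>' s, cscale (r s) w + a *\<^sub>R cscale (r' s) x)"
    if "s \<in> I" "(a, w) \<in> tangent_space ?M (s, x)" for s x a w
  proof -
    note d = has_derivative_pair_cscale[OF smooth_on_has_vector_derivative[OF assms(4) that(1)]
        smooth_on_has_vector_derivative[OF assms(7) that(1)], of x "sphere 0 1"]
    have "(?X has_derivative differential_on ?M ?X (s, x)) (at (s, x) within ?M)"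
      using d frechet_derivative_works differentiable_def by blast
    from derivative_unique_on_tangent_space[OF this d that(2)] show ?thesis
      by (simp add: \<gamma>'_def r'_def)
  qed
  have T: "x \<bullet> w = 0" if "(a, w) \<in> tangent_space ?M (s, x)" "s \<in> I" "norm x = 1" for a w s and x :: "real^'n"
    using that(1) unfolding tangent_space_interval_sphere[OF assms(2,3) that(2,3)] by simp
  have inj: "inj_on (differential_on ?M ?X (s, x)) (tangent_space ?M (s, x))"
    if s: "s \<in> I" for s x
  proof (rule inj_onI; clarify)
    fix a w b u assume *: "(a, w) \<in> tangent_space ?M (s, x)" "(b, u) \<in> tangent_space ?M (s, x)"
      "differential_on ?M ?X (s, x) (a, w) = differential_on ?M ?X (s, x) (b, u)"
    then have eq: "a *\<^sub>R \<gamma>' s = b *\<^sub>R \<gamma>' s"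
      "cscale (r s) w + a *\<^sub>R cscale (r' s) x = cscale (r s) u + b *\<^sub>R cscale (r' s) x"
      by (auto simp: D s)
    have "\<gamma>' s \<noteq> 0" "r s \<noteq> 0" using s assms(5,6,8) by (auto simp: \<gamma>'_def)
    with eq show "a = b \<and> w = u" by (auto simp: cscale_def vec_eq_iff)
  qed
  have pull: "pullback_form ?M ?X omega0 (s, x) v v' = 0"
    if "s \<in> I" "norm x = 1" "v \<in> tangent_space ?M (s, x)" "v' \<in> tangent_space ?M (s, x)" for s x v v'
    using that by (cases v; cases v') (auto simp: pullback_form_def D intro!: omega0_cscale_eq_0 dest: T)
  have dims: "dim (tangent_space (quadric P) (?X (s, x))) = 2 * dim (tangent_space ?M (s, x))"
    if "s \<in> I" "norm x = 1" for s x
    using that assms(6) inQ[OF that]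
    by (simp add: dim_tangent_space_interval_sphere[OF assms(2,3)] dim_tangent_space_quadric)
  have "lagrangian_immersion ?M (quadric P) omega0 ?X"
    unfolding lagrangian_immersion_def immersion_on_def
    using smooth_on_pair_cscale[OF assms(4,7)] inQ inj pull dims by auto
  then show ?thesis by (simp add: cscale_def)
qed

end
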